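(* For every positive integer $n$, the critical exponent $m(n)$ satisfies $$m(n)\le \begin{cases}\dfrac{n^2-4n+5}{2} & \text{if } n \text{ is odd},\\[2mm] \dfrac{n^2-5n+8}{2} & \text{if } n \text{ is even}.\end{cases}$$
   Context: A real $n$-by-$n$ matrix is doubly nonnegative if it is symmetric, positive semidefinite, and entry-wise nonnegative. For positive semidefinite $A=\sum_i\lambda_ix_ix_i^T$ (orthonormal eigenvectors) and $t>0$, $A^t=\sum_i\lambda_i^tx_ix_i^T$. The (conventional) critical exponent $m(n)$ is the least value $m$ such that $A^t$ is doubly nonnegative for all $t\ge m$ and all $n$-by-$n$ doubly nonnegative matrices $A$. *)

theory Defs
  imports "HOL-Analysis.Analysis"
begin

definition outer_prod :: "real^'n \<Rightarrow> real^'n \<Rightarrow> real^'n^'n" where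
  "outer_prod v w = (\<chi> r c. v $ r * w $ c)"

definition psd_matrix :: "real^'n^'n \<Rightarrow> bool" where
  "psd_matrix A \<longleftrightarrow> transpose A = A \<and> (\<forall>v. 0 \<le> v \<bullet> (A *v v))"

definition doubly_nonneg :: "real^'n^'n \<Rightarrow> bool" where
  "doubly_nonneg A \<longleftrightarrow> transpose A = A \<and> psd_matrix A \<and> (\<forall>i j. 0 \<le> A $ i $ j)"

definition spectral_decomp :: "real^'n^'n \<Rightarrow> ('n \<Rightarrow> real) \<Rightarrow> ('n \<Rightarrow> real^'n) \<Rightarrow> bool" where
  "spectral_decomp A lam x \<longleftrightarrow>
     (\<forall>i j. x i \<bullet> x j = (if i = j then 1 else 0)) \<and>
     A = (\<Sum>i\<in>UNIV. lam i *\<^sub>R outer_prod (x i) (x i))"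

text \<open>A^t = sum_i lambda_i^t x_i x_i^T for positive semidefinite A and t > 0.\<close>
definition mat_powr :: "real^'n^'n \<Rightarrow> real \<Rightarrow> real^'n^'n" where
  "mat_powr A t = (SOME B. \<exists>lam x. spectral_decomp A lam x \<and>
       B = (\<Sum>i\<in>UNIV. (lam i powr t) *\<^sub>R outer_prod (x i) (x i)))"

text \<open>Conventional critical exponent m(n), n = CARD('n). Only t > 0 is meaningful,
  so m ranges over nonnegative reals.\<close>
definition crit_exp :: "('n::finite) itself \<Rightarrow> real" where
  "crit_exp _ = Inf {m. 0 \<le> m \<and> (\<forall>t::real. t \<ge> m \<and> t > 0 \<longrightarrow>
       (\<forall>A::real^'n^'n. doubly_nonneg A \<longrightarrow> doubly_nonneg (mat_powr A t)))}"

end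

theory Submission
  imports Defs
begin

text \<open>Replacing \<open>A\<close> by \<open>A + \<epsilon> I\<close> we may assume that \<open>A\<close> is positive definite. An off-diagonal entry
  \<open>f(t)\<close> of \<open>A\<^sup>t\<close> is then an exponential sum with at most \<open>n\<close> terms, \<open>f(0) = 0\<close>, and \<open>f\<close> is nonnegative
  at the positive integers. If \<open>f\<close> is negative inside \<open>r\<close> of the unit intervals \<open>[k, k + 1]\<close>, \<open>k \<ge> 1\<close>,
  then \<open>f\<close> alternates weakly in sign at \<open>2r + 2\<close> points (starting at \<open>0\<close>), so \<open>2r + 2 \<le> n\<close> by Descartes'
  rule. Equality forces the signs of all coefficients, and orthogonality of the rows of the
  eigenvector matrix allows this for at most one entry of each column. Finally, a column of \<open>A\<^sup>t\<close>
  that is nonnegative for all \<open>t\<close> in \<open>[k, k + 1]\<close> stays so for all \<open>t \<ge> k\<close>, because \<open>A\<close> is entrywise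
  nonnegative; so the unit intervals with a negative entry in the column form an initial segment,
  whose length is bounded by adding up the bounds on \<open>r\<close> over the column.\<close>

section \<open>Weakly alternating exponential sums\<close>

definition exp_sum :: "real set \<Rightarrow> (real \<Rightarrow> real) \<Rightarrow> real \<Rightarrow> real" where
  "exp_sum S c t = (\<Sum>a\<in>S. c a * exp (a * t))"

text \<open>Weak inequalities let a zero of \<open>f\<close> count with either sign, as the zero at
  the origin does later. Only the sign of \<open>e\<close> matters.\<close>

definition weakly_alternating :: "real \<Rightarrow> nat \<Rightarrow> (nat \<Rightarrow> real) \<Rightarrow> (real \<Rightarrow> real) \<Rightarrow> bool" where
  "weakly_alternating e p t f \<longleftrightarrow>
     (\<forall>i. Suc i < p \<longrightarrow> t i < t (Suc i)) \<and> (\<forall>i<p. 0 \<le> e * (-1) ^ i * f (t i))"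

lemma weakly_alternating_mono:
  "weakly_alternating e p t f \<Longrightarrow> q \<le> p \<Longrightarrow> weakly_alternating e q t f"
  unfolding weakly_alternating_def by auto

lemma weakly_alternating_extend:
  assumes "weakly_alternating e (Suc p) t f" "t p < x" "0 \<le> e * (-1) ^ Suc p * f x"
  shows "weakly_alternating e (Suc (Suc p)) (t(Suc p := x)) f"
  using assms unfolding weakly_alternating_def by (auto simp: less_Suc_eq)

text \<open>Dividing by \<open>exp (b * t)\<close> and differentiating kills the term with exponent \<open>b\<close>;
  the mean value theorem transfers the alternation and costs one point.\<close>
lemma weakly_alternating_exp_sum_derivative:
  assumes fin: "finite S" and b: "b \<in> S"
    and alt: "weakly_alternating e (Suc p) t (exp_sum S c)"
  obtains u where "weakly_alternating (- e) p u (exp_sum (S - {b}) (\<lambda>a. (a - b) * c a))"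
proof -
  define h where "h s = (\<Sum>a\<in>S. c a * exp ((a - b) * s))" for s
  define g where "g = exp_sum (S - {b}) (\<lambda>a. (a - b) * c a)"
  have h_eq: "h s = exp (- b * s) * exp_sum S c s" for s
    unfolding h_def exp_sum_def sum_distrib_left
    by (intro sum.cong refl) (simp add: algebra_simps flip: exp_add)
  have g_eq: "(\<Sum>a\<in>S. (a - b) * c a * exp ((a - b) * s)) = exp (- b * s) * g s" for s
  proof -
    have "(\<Sum>a\<in>S. (a - b) * c a * exp ((a - b) * s))
        = (\<Sum>a\<in>S - {b}. (a - b) * c a * exp ((a - b) * s))"
      using fin b by (intro sum.mono_neutral_right) auto
    also have "\<dots> = exp (- b * s) * g s"
      unfolding g_def exp_sum_def sum_distrib_left
      by (intro sum.cong refl) (simp add: left_diff_distrib exp_diff exp_minus field_simps)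
    finally show ?thesis .
  qed
  have deriv: "(h has_real_derivative exp (- b * s) * g s) (at s)" for s
    unfolding h_def g_eq[symmetric]
    by (auto intro!: derivative_eq_intros sum.cong simp: algebra_simps)
  have h_alt: "0 \<le> e * (-1) ^ i * h (t i)" if "i < Suc p" for i
  proof -
    have "0 \<le> exp (- b * t i) * (e * (-1) ^ i * exp_sum S c (t i))"
      using alt that unfolding weakly_alternating_def
      by (intro mult_nonneg_nonneg[OF exp_ge_zero]) blast
    then show ?thesis by (simp add: h_eq mult_ac)
  qed
  have "\<exists>v. t i < v \<and> v < t (Suc i) \<and> 0 \<le> - e * (-1) ^ i * g v" if i: "i < p" for i
  proof -
    have lt: "t i < t (Suc i)" using alt i unfolding weakly_alternating_def by auto
    obtain v where v: "t i < v" "v < t (Suc i)"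
      and eq: "h (t (Suc i)) - h (t i) = (t (Suc i) - t i) * (exp (- b * v) * g v)"
      using MVT2[OF lt, of h "\<lambda>s. exp (- b * s) * g s"] deriv by auto
    \<comment> \<open>The increment of \<open>h\<close> weakly carries the sign opposite to
      \<open>h (t i)\<close>, so the new sequence starts with \<open>- e\<close>.\<close>
    have "0 \<le> - e * (-1) ^ i * (h (t (Suc i)) - h (t i))"
      using h_alt[of i] h_alt[of "Suc i"] i by (simp add: algebra_simps)
    also have "\<dots> = ((t (Suc i) - t i) * exp (- b * v)) * (- e * (-1) ^ i * g v)"
      unfolding eq by (simp add: mult_ac)
    finally have "0 \<le> - e * (-1) ^ i * g v"
      using lt by (subst (asm) zero_le_mult_iff) (simp add: not_le[symmetric] mult_le_0_iff)
    with v show ?thesis by blast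
  qed
  then obtain u where u: "\<And>i. i < p \<Longrightarrow> t i < u i \<and> u i < t (Suc i) \<and> 0 \<le> - e * (-1) ^ i * g (u i)"
    by metis
  have "weakly_alternating (- e) p u g"
    unfolding weakly_alternating_def
  proof (intro conjI allI impI)
    fix i assume "Suc i < p"
    with u[of i] u[of "Suc i"] show "u i < u (Suc i)" by auto
  next
    fix i assume "i < p"
    with u[of i] show "0 \<le> - e * (-1) ^ i * g (u i)" by simp
  qed
  with that show thesis unfolding g_def by blast
qed

text \<open>A single exponential keeps one sign, so it cannot alternate at two points unless it
  vanishes.\<close>

lemma exp_sum_single_term_alternating:
  assumes "finite S" "b \<in> S" and zero: "\<And>a. a \<in> S - {b} \<Longrightarrow> c a = 0"
    and alt: "weakly_alternating e p t (exp_sum S c)" and "2 \<le> p" "e \<noteq> 0"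
  shows "c b = 0"
proof -
  have eq: "exp_sum S c s = c b * exp (b * s)" for s
    unfolding exp_sum_def using assms(1,2) zero by (subst sum.remove[of _ b]) auto
  have "0 < p" "1 < p" using \<open>2 \<le> p\<close> by auto
  then have "0 \<le> e * (-1) ^ 0 * exp_sum S c (t 0)" "0 \<le> e * (-1) ^ 1 * exp_sum S c (t 1)"
    using alt unfolding weakly_alternating_def by blast+
  then have "0 \<le> (e * c b) * exp (b * t 0)" "(e * c b) * exp (b * t 1) \<le> 0"
    by (simp_all add: eq mult_ac)
  then have "0 \<le> e * c b" "e * c b \<le> 0"
    using zero_le_mult_iff[of "e * c b" "exp (b * t 0)"] mult_le_0_iff[of "e * c b" "exp (b * t 1)"]
    by (auto simp: not_le[symmetric])
  then have "e * c b = 0" by linarith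
  with \<open>e \<noteq> 0\<close> show ?thesis by simp
qed

text \<open>Descartes' rule: removing a term \<open>b\<close> costs one point, so by induction all
  other coefficients vanish, and a single term with at least two points is left.\<close>

lemma exp_sum_alternating_vanishes:
  assumes "finite S" "e \<noteq> 0" "weakly_alternating e (Suc (card S)) t (exp_sum S c)" "a \<in> S"
  shows "c a = 0"
  using assms
proof (induction "card S" arbitrary: S e t c a)
  case 0
  then show ?case by simp
next
  case (Suc n)
  have zero: "c a' = 0" if a': "a' \<in> S - {b}" and b: "b \<in> S" for a' b
  proof -
    obtain u where u: "weakly_alternating (- e) (card S) u (exp_sum (S - {b}) (\<lambda>a. (a - b) * c a))"
      using weakly_alternating_exp_sum_derivative[OF Suc.prems(1) b Suc.prems(3)] by blast
    have "n = card (S - {b})" using Suc.hyps(2) b Suc.prems(1) by simp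
    moreover have "weakly_alternating (- e) (Suc (card (S - {b}))) u (exp_sum (S - {b}) (\<lambda>a. (a - b) * c a))"
      using u calculation Suc.hyps(2) by simp
    ultimately have "(a' - b) * c a' = 0"
      using Suc.hyps(1)[of "S - {b}" "- e" u "\<lambda>a. (a - b) * c a" a'] Suc.prems(1,2) a' by simp
    with a' show ?thesis by simp
  qed
  show ?case
    using exp_sum_single_term_alternating[OF Suc.prems(1,4) _ Suc.prems(3) _ Suc.prems(2)]
      zero Suc.prems(4) Suc.hyps(2) by fastforce
qed

text \<open>The extremal case of Descartes' rule of signs: alternation at as many points as there are terms
  forces the sign of every coefficient.\<close>
lemma exp_sum_alternating_coeff_signs:
  assumes "finite S" "e \<noteq> 0"
    and "weakly_alternating e (card S) t (exp_sum S c)" "\<exists>a\<in>S. c a \<noteq> 0"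
    and "weakly_alternating e (card S) t' (exp_sum S d)" "\<exists>a\<in>S. d a \<noteq> 0"
    and "a \<in> S"
  shows "0 < c a * d a"
  using assms
proof (induction "card S" arbitrary: S e t t' c d a)
  case 0
  then show ?case by simp
next
  case (Suc n)
  show ?case
  proof (cases "n = 0")
    case True
    with Suc have S: "S = {a}" by (metis One_nat_def card_1_singletonE singletonD)
    have "0 \<le> (e * c a) * exp (a * t 0)" "0 \<le> (e * d a) * exp (a * t' 0)"
      using Suc.prems(3,5) unfolding weakly_alternating_def exp_sum_def S by (auto simp: mult_ac)
    then have "0 \<le> e * c a" "0 \<le> e * d a" by (simp_all add: zero_le_mult_iff)
    then have "0 \<le> (e * c a) * (e * d a)" by (rule mult_nonneg_nonneg)
    moreover have "(e * c a) * (e * d a) \<noteq> 0" using Suc.prems(2,4,6) S by auto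
    ultimately have "0 < (e * c a) * (e * d a)" by linarith
    then have "0 < (e * e) * (c a * d a)" by (simp add: mult_ac)
    moreover have "0 < e * e" using \<open>e \<noteq> 0\<close> by (metis not_real_square_gt_zero)
    ultimately show ?thesis by (simp add: zero_less_mult_iff)
  next
    case False
    then have "S \<noteq> {a}" using Suc.hyps(2) by auto
    \<comment> \<open>The term at \<open>a\<close> survives the removal of \<open>b\<close>.
      Removing the same \<open>b\<close> from both sums gives the product at \<open>a\<close> only
      the positive factor \<open>(a - b) * (a - b)\<close>.\<close>
    then obtain b where b: "b \<in> S" "b \<noteq> a" using Suc.prems(7) by blast
    have cd: "card S = Suc n" and cd': "n = card (S - {b})"
      using Suc.hyps(2) Suc.prems(1) b by auto
    have nz: "\<exists>a\<in>S - {b}. (a - b) * c' a \<noteq> 0"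
      if "weakly_alternating e (card S) s (exp_sum S c')" "\<exists>a\<in>S. c' a \<noteq> 0" for s c'
    proof (rule ccontr)
      assume "\<not> ?thesis"
      then have z: "c' a = 0" if "a \<in> S - {b}" for a using that by auto
      have "c' b = 0"
        using exp_sum_single_term_alternating[OF Suc.prems(1) b(1) z that(1) _ Suc.prems(2)] cd False
        by linarith
      with z that(2) show False by blast
    qed
    obtain u where u: "weakly_alternating (- e) n u (exp_sum (S - {b}) (\<lambda>a. (a - b) * c a))"
      using weakly_alternating_exp_sum_derivative[OF Suc.prems(1) b(1) Suc.prems(3)[unfolded cd]] by blast
    obtain u' where u': "weakly_alternating (- e) n u' (exp_sum (S - {b}) (\<lambda>a. (a - b) * d a))"
      using weakly_alternating_exp_sum_derivative[OF Suc.prems(1) b(1) Suc.prems(5)[unfolded cd]] by blast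
    have "0 < ((a - b) * c a) * ((a - b) * d a)"
      using Suc.hyps(1)[OF cd' _ _ u[unfolded cd'] nz[OF Suc.prems(3,4)] u'[unfolded cd'] nz[OF Suc.prems(5,6)]]
        Suc.prems(1,2,7) b by simp
    then have "0 < ((a - b) * (a - b)) * (c a * d a)" by (simp add: mult_ac)
    then show ?thesis by (simp add: zero_less_mult_iff)
  qed
qed

section \<open>Sign alternation across unit intervals\<close>

lemma weakly_alternating_unit_intervals:
  fixes f :: "real \<Rightarrow> real" and B :: "nat set"
  assumes "finite B" and f0: "f 0 = 0" and fk: "\<And>k::nat. 1 \<le> k \<Longrightarrow> 0 \<le> f (real k)"
    and neg: "\<And>k. k \<in> B \<Longrightarrow> 1 \<le> k \<and> (\<exists>s. real k < s \<and> s < real k + 1 \<and> f s < 0)"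
  obtains t where "weakly_alternating (-1) (2 * card B + 2) t f"
proof -
  \<comment> \<open>Each \<open>k\<close> in \<open>B\<close> contributes the integer
    \<open>k\<close>, where \<open>f\<close> is nonnegative, and then a point of negative value; 0
    comes first, counted as nonpositive. The bound on the last point lets the next integer be
    appended.\<close>
  have "\<exists>t. weakly_alternating (-1) (Suc (2 * card B)) t f \<and>
      (\<forall>m::nat. 1 \<le> m \<longrightarrow> (\<forall>k\<in>B. k < m) \<longrightarrow> t (2 * card B) < real m)"
    using \<open>finite B\<close> neg
  proof (induction B rule: finite_linorder_max_induct)
    case empty
    show ?case by (rule exI[of _ "\<lambda>_. 0"]) (simp add: weakly_alternating_def f0)
  next
    case (insert b A)
    let ?r = "2 * card A"
    obtain t where t: "weakly_alternating (-1) (Suc ?r) t f"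
      and lim: "\<And>m::nat. 1 \<le> m \<Longrightarrow> (\<forall>k\<in>A. k < m) \<Longrightarrow> t ?r < real m"
      using insert by auto
    obtain s where b: "1 \<le> b" and s: "real b < s" "s < real b + 1" "f s < 0"
      using insert.prems[of b] by auto
    have t1: "weakly_alternating (-1) (Suc (Suc ?r)) (t(Suc ?r := real b)) f"
      using lim[OF b] insert.hyps fk[OF b] by (intro weakly_alternating_extend[OF t]) auto
    have t2: "weakly_alternating (-1) (Suc (Suc (Suc ?r))) (t(Suc ?r := real b, Suc (Suc ?r) := s)) f"
      using s by (intro weakly_alternating_extend[OF t1]) auto
    have "b \<notin> A" using insert.hyps by auto
    then have card: "2 * card (insert b A) = Suc (Suc ?r)" using insert.hyps by simp
    have "s < real m" if "b < m" for m
    proof -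
      have "real b + 1 \<le> real m" using that by linarith
      with s show ?thesis by linarith
    qed
    then have "\<forall>m::nat. 1 \<le> m \<longrightarrow> (\<forall>k\<in>insert b A. k < m) \<longrightarrow>
        (t(Suc ?r := real b, Suc (Suc ?r) := s)) (Suc (Suc ?r)) < real m" by simp
    with t2 show ?case unfolding card by blast
  qed
  then obtain t where t: "weakly_alternating (-1) (Suc (2 * card B)) t f"
    and lim: "\<And>m::nat. 1 \<le> m \<Longrightarrow> (\<forall>k\<in>B. k < m) \<Longrightarrow> t (2 * card B) < real m" by blast
  \<comment> \<open>An integer beyond \<open>B\<close> is the final nonnegative point; inserting 0
    covers empty \<open>B\<close>.\<close>
  define m where "m = Suc (Max (insert 0 B))"
  have "\<forall>k\<in>B. k < m" using \<open>finite B\<close> by (auto simp: m_def less_Suc_eq_le)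
  moreover have "1 \<le> m" by (simp add: m_def)
  ultimately have "weakly_alternating (-1) (Suc (Suc (2 * card B))) (t(Suc (2 * card B) := real m)) f"
    using t lim fk[of m] by (intro weakly_alternating_extend) auto
  with that show thesis by simp
qed

section \<open>Powers of a positive definite matrix with nonnegative entries\<close>

lemma orthonormal_transpose:
  fixes x :: "'n::finite \<Rightarrow> real^'n"
  assumes "\<And>i j. x i \<bullet> x j = (if i = j then 1 else 0)"
  shows "transpose (\<chi> k. x k) ** (\<chi> k. x k) = mat 1"
proof -
  have "(\<chi> k. x k) ** transpose (\<chi> k. x k) = mat 1"
    using assms by (simp add: vec_eq_iff matrix_matrix_mult_def transpose_def mat_def inner_vec_def)
  then show ?thesis by (simp add: matrix_left_right_inverse)
qed

lemma orthonormal_rows: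
  fixes x :: "'n::finite \<Rightarrow> real^'n"
  assumes "\<And>i j. x i \<bullet> x j = (if i = j then 1 else 0)"
  shows "(\<Sum>k\<in>UNIV. x k $ i * x k $ j) = (if i = j then 1 else 0)"
proof -
  have "(transpose (\<chi> k. x k) ** (\<chi> k. x k)) $ i $ j = (mat 1 :: real^'n^'n) $ i $ j"
    by (simp add: orthonormal_transpose[OF assms])
  then show ?thesis by (simp add: matrix_matrix_mult_def transpose_def mat_def)
qed

text \<open>Positive \<open>mu\<close> makes the zeroth power the identity (\<open>0 powr 0\<close>
  is 0) and each entry of a power an exponential sum.\<close>

locale positive_spectral_data =
  fixes mu :: "'n::finite \<Rightarrow> real" and x :: "'n \<Rightarrow> real^'n"
  assumes orthonormal: "x i \<bullet> x j = (if i = j then 1 else 0)"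
    and mu_pos: "0 < mu i"
    and entry_nonneg: "0 \<le> (\<Sum>k\<in>UNIV. mu k * (x k $ i * x k $ j))"
begin

definition pow :: "real \<Rightarrow> 'n \<Rightarrow> 'n \<Rightarrow> real" where
  "pow t i j = (\<Sum>k\<in>UNIV. mu k powr t * (x k $ i * x k $ j))"

lemmas rows_orthonormal = orthonormal_rows[OF orthonormal]

lemma pow_0: "pow 0 i j = (if i = j then 1 else 0)"
  using rows_orthonormal[of i j] mu_pos by (simp add: pow_def less_imp_neq[symmetric])

lemma pow_1_nonneg: "0 \<le> pow 1 i j"
  using entry_nonneg[of i j] mu_pos by (simp add: pow_def less_imp_le)

lemma pow_diag_nonneg: "0 \<le> pow t i i"
  unfolding pow_def by (intro sum_nonneg mult_nonneg_nonneg[OF powr_ge_zero] zero_le_square)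

lemma pow_add: "pow (s + t) i j = (\<Sum>l\<in>UNIV. pow s i l * pow t l j)"
proof -
  have "(\<Sum>l\<in>UNIV. pow s i l * pow t l j)
      = (\<Sum>l\<in>UNIV. \<Sum>k\<in>UNIV. \<Sum>k'\<in>UNIV. mu k powr s * mu k' powr t * x k $ i * x k' $ j * (x k $ l * x k' $ l))"
    by (simp add: pow_def sum_product mult_ac)
  also have "\<dots> = (\<Sum>k\<in>UNIV. \<Sum>k'\<in>UNIV. \<Sum>l\<in>UNIV. mu k powr s * mu k' powr t * x k $ i * x k' $ j * (x k $ l * x k' $ l))"
    by (subst sum.swap) (intro sum.cong refl sum.swap)
  also have "\<dots> = (\<Sum>k\<in>UNIV. \<Sum>k'\<in>UNIV. mu k powr s * mu k' powr t * x k $ i * x k' $ j * (x k \<bullet> x k'))"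
    by (simp add: inner_vec_def sum_distrib_left)
  also have "\<dots> = pow (s + t) i j"
    by (simp add: orthonormal pow_def powr_add mult_ac if_distrib cong: if_cong)
  finally show ?thesis by simp
qed

text \<open>Left multiplication by the nonnegative matrix \<open>pow 1\<close> acts on each column
  separately; this is why the whole argument runs column by column.\<close>

lemma pow_column_step:
  assumes "\<And>i. 0 \<le> pow t i j"
  shows "0 \<le> pow (t + 1) i j"
  unfolding add.commute[of t 1] pow_add
  by (intro sum_nonneg mult_nonneg_nonneg pow_1_nonneg assms)

lemma pow_column_add_nat:
  assumes "\<And>i. 0 \<le> pow t i j"
  shows "0 \<le> pow (t + real m) i j"
proof (induction m arbitrary: i)
  case (Suc m)
  from pow_column_step[OF this] show ?case by (simp add: add_ac)
qed (simp add: assms)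

lemma pow_nat_nonneg: "0 \<le> pow (real k) i j"
  using pow_column_add_nat[of 0 j k i] by (simp add: pow_0)

section \<open>Entries of powers as exponential sums\<close>

definition exponents :: "real set" where
  "exponents = range (\<lambda>k. ln (mu k))"

text \<open>Equal eigenvalues are merged, as the exponents of \<open>exp_sum\<close> form a
  set.\<close>

definition coeff :: "'n \<Rightarrow> 'n \<Rightarrow> real \<Rightarrow> real" where
  "coeff i j a = (\<Sum>k | ln (mu k) = a. x k $ i * x k $ j)"

lemma finite_exponents: "finite exponents"
  by (simp add: exponents_def)

lemma card_exponents_le: "card exponents \<le> CARD('n)"
  unfolding exponents_def by (rule card_image_le) simp

lemma pow_eq_exp_sum: "pow t i j = exp_sum exponents (coeff i j) t"
proof -
  have "exp_sum exponents (coeff i j) t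
      = (\<Sum>a\<in>exponents. \<Sum>k | k \<in> UNIV \<and> ln (mu k) = a. mu k powr t * (x k $ i * x k $ j))"
    unfolding exp_sum_def coeff_def sum_distrib_right
    using mu_pos by (intro sum.cong refl) (auto simp: powr_def mult_ac less_imp_neq[symmetric])
  also have "\<dots> = pow t i j"
    unfolding pow_def exponents_def by (rule sum.group) auto
  finally show ?thesis by simp
qed

text \<open>The interval from 0 to 1 is left out: the value at 0 already serves as nonpositive, and
  a nonnegative integer point has to precede each negative one.\<close>

definition bad :: "'n \<Rightarrow> 'n \<Rightarrow> nat set" where
  "bad j i = {k. 1 \<le> k \<and> (\<exists>s. real k < s \<and> s < real k + 1 \<and> pow s i j < 0)}"

lemma alternating_on_bad:
  assumes "i \<noteq> j" "finite B" "B \<subseteq> bad j i"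
  obtains t where "weakly_alternating (-1) (2 * card B + 2) t (exp_sum exponents (coeff i j))"
proof (rule weakly_alternating_unit_intervals[OF assms(2), of "exp_sum exponents (coeff i j)"])
  show "exp_sum exponents (coeff i j) 0 = 0"
    using assms(1) by (simp add: pow_0 flip: pow_eq_exp_sum)
  show "0 \<le> exp_sum exponents (coeff i j) (real k)" for k
    by (simp add: pow_nat_nonneg flip: pow_eq_exp_sum)
  show "1 \<le> k \<and> (\<exists>s>real k. s < real k + 1 \<and> exp_sum exponents (coeff i j) s < 0)" if "k \<in> B" for k
    using assms(3) that unfolding bad_def pow_eq_exp_sum by auto
qed (use that in blast)

lemma bad_coeff_nonzero: "bad j i \<noteq> {} \<Longrightarrow> \<exists>a\<in>exponents. coeff i j a \<noteq> 0"
proof (rule ccontr)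
  assume ne: "bad j i \<noteq> {}" and "\<not> (\<exists>a\<in>exponents. coeff i j a \<noteq> 0)"
  then have "pow s i j = 0" for s by (simp add: pow_eq_exp_sum exp_sum_def)
  with ne show False by (simp add: bad_def)
qed

text \<open>More alternations would annihilate all coefficients, leaving no negative value. Stating
  this for finite subsets also yields finiteness of \<open>bad j i\<close>.\<close>

lemma card_sub_bad_le:
  assumes "i \<noteq> j" "finite B" "B \<subseteq> bad j i" "B \<noteq> {}"
  shows "2 * card B + 2 \<le> card exponents"
proof (rule ccontr)
  assume "\<not> ?thesis"
  then have le: "Suc (card exponents) \<le> 2 * card B + 2" by simp
  obtain t where "weakly_alternating (-1) (2 * card B + 2) t (exp_sum exponents (coeff i j))"
    using alternating_on_bad[OF assms(1-3)] by blast
  from weakly_alternating_mono[OF this le]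
  have "coeff i j a = 0" if "a \<in> exponents" for a
    using exp_sum_alternating_vanishes[OF finite_exponents _ _ that, of "-1"] by auto
  moreover have "bad j i \<noteq> {}" using assms(3,4) by auto
  ultimately show False using bad_coeff_nonzero by blast
qed

lemma finite_bad:
  assumes "i \<noteq> j"
  shows "finite (bad j i)"
proof (rule ccontr)
  assume "infinite (bad j i)"
  then obtain B where "finite B" "card B = Suc (card exponents)" "B \<subseteq> bad j i"
    by (meson infinite_arbitrarily_large)
  moreover have "B \<noteq> {}" using calculation(2) by auto
  ultimately show False using card_sub_bad_le[OF assms, of B] by simp
qed

lemma card_bad_le:
  assumes "i \<noteq> j"
  shows "2 * card (bad j i) + 2 \<le> CARD('n)"
proof (cases "bad j i = {}")
  case True
  have "card {i, j} \<le> CARD('n)" by (rule card_mono) auto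
  with True assms show ?thesis by simp
next
  case False
  with card_sub_bad_le[OF assms finite_bad[OF assms] order_refl] card_exponents_le
  show ?thesis by linarith
qed

text \<open>Two extremal entries of a column have coefficients of equal signs, so rows
  \<open>i\<close> and \<open>i'\<close> of the eigenvector matrix agree in sign everywhere and
  cannot be orthogonal.\<close>

lemma card_bad_extremal_unique:
  assumes "i \<noteq> j" "i' \<noteq> j" "4 \<le> CARD('n)"
    and "2 * card (bad j i) + 2 = CARD('n)" "2 * card (bad j i') + 2 = CARD('n)"
  shows "i = i'"
proof (rule ccontr)
  assume "i \<noteq> i'"
  have ne: "bad j i \<noteq> {}" "bad j i' \<noteq> {}" using assms(3-5) by auto
  have card: "card exponents = CARD('n)"
    using card_sub_bad_le[OF assms(1) finite_bad[OF assms(1)] order_refl ne(1)] card_exponents_le assms(4)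
    by linarith
  \<comment> \<open>With as many exponents as indices the eigenvalues are distinct, so each
    coefficient is a single product.\<close>
  then have "inj (\<lambda>k. ln (mu k))" unfolding exponents_def by (intro eq_card_imp_inj_on) auto
  then have "{k'. ln (mu k') = ln (mu k)} = {k}" for k by (auto dest: injD)
  then have coeff: "coeff i j (ln (mu k)) = x k $ i * x k $ j" for i k by (simp add: coeff_def)
  obtain t where t: "weakly_alternating (-1) (card exponents) t (exp_sum exponents (coeff i j))"
    using alternating_on_bad[OF assms(1) finite_bad[OF assms(1)] order_refl] card assms(4) by metis
  obtain t' where t': "weakly_alternating (-1) (card exponents) t' (exp_sum exponents (coeff i' j))"
    using alternating_on_bad[OF assms(2) finite_bad[OF assms(2)] order_refl] card assms(5) by metis
  have "0 < x k $ i * x k $ i'" for k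
  proof -
    have "0 < coeff i j (ln (mu k)) * coeff i' j (ln (mu k))"
      using exp_sum_alternating_coeff_signs[OF finite_exponents _ t bad_coeff_nonzero[OF ne(1)]
          t' bad_coeff_nonzero[OF ne(2)], of "ln (mu k)"] by (simp add: exponents_def)
    then have "0 < (x k $ j * x k $ j) * (x k $ i * x k $ i')" by (simp add: coeff mult_ac)
    then show ?thesis by (simp add: zero_less_mult_iff)
  qed
  then have "0 < (\<Sum>k\<in>UNIV. x k $ i * x k $ i')" by (intro sum_pos) auto
  with rows_orthonormal[of i i'] \<open>i \<noteq> i'\<close> show False by simp
qed

text \<open>For odd \<open>n\<close> parity lowers \<open>n - 2\<close> to \<open>n - 3\<close> in
  each of \<open>n - 1\<close> entries; for even \<open>n\<close> at most one entry attains
  \<open>n - 2\<close> and the others stay at or below \<open>n - 4\<close>.\<close>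

lemma sum_card_bad_le:
  fixes j :: 'n
  defines "n \<equiv> int CARD('n)"
  shows "2 * (\<Sum>i\<in>UNIV - {j}. int (card (bad j i))) \<le> (if odd n then (n - 1) * (n - 3) else (n - 2) * (n - 3))"
proof -
  let ?I = "UNIV - {j}"
  have cI: "int (card ?I) = n - 1" by (simp add: n_def card_Diff_singleton)
  have le: "2 * int (card (bad j i)) \<le> n - 2" if "i \<in> ?I" for i
    using card_bad_le[of i j] that by (simp add: n_def)
  show ?thesis
  proof (cases "odd n")
    case True
    have "2 * int (card (bad j i)) \<le> n - 3" if "i \<in> ?I" for i
      using le[OF that] True by presburger
    then have "(\<Sum>i\<in>?I. 2 * int (card (bad j i))) \<le> of_nat (card ?I) * (n - 3)"
      by (rule sum_bounded_above)
    with True cI show ?thesis by (simp add: sum_distrib_left)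
  next
    case False
    define X where "X = {i \<in> ?I. 2 * int (card (bad j i)) = n - 2}"
    have n2: "2 \<le> n"
    proof -
      have "0 < n" by (simp add: n_def)
      with False show ?thesis by presburger
    qed
    show ?thesis
    \<comment> \<open>Here \<open>n - 2\<close> is already 0; the uniqueness of the extremal entry
      is available from \<open>n = 4\<close> on.\<close>
    proof (cases "n = 2")
      case True
      then have "int (card (bad j i)) = 0" if "i \<in> ?I" for i using le[OF that] by simp
      then show ?thesis using False True by simp
    next
      case nn: False
      with n2 False have n4: "4 \<le> n" by presburger
      have uniq: "i = i'" if "i \<in> X" "i' \<in> X" for i i'
        using that n4 by (intro card_bad_extremal_unique[of i j i']) (auto simp: X_def n_def)
      have "card X \<le> 1" using uniq by (simp add: card_le_Suc0_iff_eq)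
      have "2 * int (card (bad j i)) \<le> (n - 4) + (if i \<in> X then 2 else 0)" if "i \<in> ?I" for i
        using le[OF that] False that unfolding X_def by simp presburger
      then have "(\<Sum>i\<in>?I. 2 * int (card (bad j i))) \<le> (\<Sum>i\<in>?I. (n - 4) + (if i \<in> X then 2 else 0))"
        by (rule sum_mono)
      also have "\<dots> = (n - 1) * (n - 4) + 2 * int (card X)"
      proof -
        have "?I \<inter> X = X" by (auto simp: X_def)
        then show ?thesis using cI by (simp add: sum.distrib sum.inter_restrict[symmetric])
      qed
      also have "\<dots> \<le> (n - 1) * (n - 4) + 2" using \<open>card X \<le> 1\<close> by simp
      also have "\<dots> = (n - 2) * (n - 3)" by (simp add: algebra_simps)
      finally show ?thesis using False by (simp add: sum_distrib_left)
    qed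
  qed
qed

section \<open>From bad intervals in a column to a bound on the exponent\<close>

lemma negative_imp_all_bad:
  assumes "pow t i j < 0" "1 \<le> k" "real k \<le> t"
  shows "k \<in> (\<Union>i\<in>UNIV - {j}. bad j i)"
proof (rule ccontr)
  assume k: "k \<notin> (\<Union>i\<in>UNIV - {j}. bad j i)"
  \<comment> \<open>Shifting by \<open>m\<close> moves \<open>t\<close> into the unit interval
    starting at \<open>k\<close>, where the column is nonnegative.\<close>
  define m where "m = nat \<lfloor>t - real k\<rfloor>"
  have m: "real m \<le> t - real k" "t - real k < real m + 1"
    using assms(3) unfolding m_def by simp_all
  have "0 \<le> pow (t - real m) l j" for l
  \<comment> \<open>The diagonal entry and the endpoint \<open>k\<close> are not covered by the
    assumption on \<open>bad\<close> and are treated directly.\<close>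
  proof (cases "l = j \<or> t - real m = real k")
    case True
    then show ?thesis using pow_diag_nonneg pow_nat_nonneg by metis
  next
    case False
    then have "k \<notin> bad j l" using k by auto
    then have "\<not> (real k < t - real m \<and> t - real m < real k + 1 \<and> pow (t - real m) l j < 0)"
      using assms(2) unfolding bad_def by blast
    with False m show ?thesis by force
  qed
  from pow_column_add_nat[OF this, of m i] assms(1) show False by simp
qed

lemma pow_nonneg:
  fixes n :: real
  defines "n \<equiv> real CARD('n)"
  assumes t: "(if odd CARD('n) then (n\<^sup>2 - 4 * n + 5) / 2 else (n\<^sup>2 - 5 * n + 8) / 2) \<le> t"
  shows "0 \<le> pow t i j"
proof (rule ccontr)
  assume "\<not> ?thesis"
  then have neg: "pow t i j < 0" by simp
  define N where "N = nat \<lfloor>t\<rfloor>"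
  define s where "s = (\<Sum>i\<in>UNIV - {j}. card (bad j i))"
  have sub: "{1..N} \<subseteq> (\<Union>i\<in>UNIV - {j}. bad j i)"
  proof
    fix k assume "k \<in> {1..N}"
    then have "1 \<le> k" "k \<le> nat \<lfloor>t\<rfloor>" unfolding N_def by auto
    then have "1 \<le> k" "real k \<le> t" by linarith+
    with neg show "k \<in> (\<Union>i\<in>UNIV - {j}. bad j i)" by (rule negative_imp_all_bad)
  qed
  have fin: "finite (\<Union>i\<in>UNIV - {j}. bad j i)" by (intro finite_UN_I) (auto intro: finite_bad)
  have "N \<le> card (\<Union>i\<in>UNIV - {j}. bad j i)"
    using card_mono[OF fin sub] by simp
  also have "\<dots> \<le> s" unfolding s_def by (rule card_UN_le) simp
  finally have "t < real s + 1" unfolding N_def by linarith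
  let ?n = "int CARD('n)"
  have "2 * int s \<le> (if odd ?n then (?n - 1) * (?n - 3) else (?n - 2) * (?n - 3))"
    using sum_card_bad_le[of j] by (simp add: s_def)
  then have "real_of_int (2 * int s) \<le> real_of_int (if odd ?n then (?n - 1) * (?n - 3) else (?n - 2) * (?n - 3))"
    by (simp only: of_int_le_iff)
  then have "2 * real s \<le> (if odd CARD('n) then (n - 1) * (n - 3) else (n - 2) * (n - 3))"
    by (simp add: n_def split: if_splits)
  \<comment> \<open>The assumed bound on \<open>t\<close> is exactly 1 more than the bound on
    \<open>s\<close>: \<open>(n - 1) * (n - 3) + 2 = n^2 - 4 * n + 5\<close> and
    \<open>(n - 2) * (n - 3) + 2 = n^2 - 5 * n + 8\<close>.\<close>
  with t \<open>t < real s + 1\<close> show False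
    by (auto simp: algebra_simps power2_eq_square split: if_splits)
qed

end

section \<open>The spectral theorem\<close>

lemma symmetric_matrix_inner:
  fixes A :: "real^'n^'n"
  assumes "transpose A = A"
  shows "v \<bullet> (A *v w) = (A *v v) \<bullet> w"
  by (metis assms dot_lmul_matrix vector_transpose_matrix)

text \<open>A maximiser of the quadratic form on the unit sphere of \<open>V\<close> is an
  eigenvector. Invariant subspaces serve the later induction on dimension.\<close>

lemma symmetric_matrix_eigenvector:
  fixes A :: "real^'n^'n"
  assumes sym: "transpose A = A" and V: "subspace V" and inv: "\<And>v. v \<in> V \<Longrightarrow> A *v v \<in> V"
    and nt: "V \<noteq> {0}"
  obtains v c where "v \<in> V" "norm v = 1" "A *v v = c *\<^sub>R v"
proof -
  let ?K = "V \<inter> sphere 0 1"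
  have "compact ?K" using V by (intro closed_Int_compact closed_subspace) auto
  obtain w where w: "w \<in> V" "w \<noteq> 0" using nt V subspace_0 by blast
  then have "(1 / norm w) *\<^sub>R w \<in> ?K" using V by (auto simp: subspace_scale)
  then have "?K \<noteq> {}" by blast
  have "continuous_on ?K (\<lambda>v. v \<bullet> (A *v v))" by (intro continuous_intros)
  from continuous_attains_sup[OF \<open>compact ?K\<close> \<open>?K \<noteq> {}\<close> this]
  obtain v where v: "v \<in> V" "norm v = 1"
    and max: "\<And>u. u \<in> V \<Longrightarrow> norm u = 1 \<Longrightarrow> u \<bullet> (A *v u) \<le> v \<bullet> (A *v v)" by auto
  define M where "M = v \<bullet> (A *v v)"
  have bound: "u \<bullet> (A *v u) \<le> M * (u \<bullet> u)" if "u \<in> V" for u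
  proof (cases "u = 0")
    case False
    have "((1 / norm u) *\<^sub>R u) \<bullet> (A *v ((1 / norm u) *\<^sub>R u)) \<le> M"
      unfolding M_def using that V False by (intro max) (auto simp: subspace_scale)
    then have "(u \<bullet> (A *v u)) / (norm u)\<^sup>2 \<le> M"
      by (simp add: matrix_vector_mult_scaleR power2_eq_square)
    then show ?thesis using False by (simp add: field_simps power2_norm_eq_inner)
  qed simp
  \<comment> \<open>The residual \<open>w\<close> is orthogonal to \<open>v\<close>; moving from
    \<open>v\<close> along \<open>w\<close> would beat the maximum to first order unless
    \<open>w\<close> is 0.\<close>
  define w where "w = A *v v - M *\<^sub>R v"
  have vv: "v \<bullet> v = 1" using v(2) by (simp add: norm_eq_1)
  have wV: "w \<in> V" unfolding w_def using V v inv by (simp add: subspace_diff subspace_scale)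
  have wv: "w \<bullet> v = 0" unfolding w_def 
    by (simp add: inner_diff_left vv M_def) (rule inner_commute)
  have Avw: "w \<bullet> (A *v v) = w \<bullet> w"
    using wv by (simp add: w_def inner_diff_right)
  define q where "q = M * (w \<bullet> w) - w \<bullet> (A *v w)"
  have key: "2 * s * (w \<bullet> w) \<le> s\<^sup>2 * q" for s
  proof -
    have "v + s *\<^sub>R w \<in> V" using V v wV by (simp add: subspace_add subspace_scale)
    from bound[OF this]
    have "M + 2 * s * (w \<bullet> (A *v v)) + s\<^sup>2 * (w \<bullet> (A *v w)) \<le> M * (1 + s\<^sup>2 * (w \<bullet> w))"
      using wv vv symmetric_matrix_inner[OF sym, of v w]
      by (simp add: M_def[symmetric] inner_commute power2_eq_square algebra_simps)
    then show ?thesis unfolding q_def Avw by (simp add: algebra_simps)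
  qed
  have "w \<bullet> w = 0"
  proof (rule ccontr)
    assume "w \<bullet> w \<noteq> 0"
    then have ww: "0 < w \<bullet> w" by simp
    \<comment> \<open>Small enough that \<open>s * q\<close> is at most
      \<open>w \<bullet> w\<close>; the 1 avoids a zero denominator.\<close>
    define s where "s = (w \<bullet> w) / (\<bar>q\<bar> + 1)"
    have s: "0 < s" "s * (\<bar>q\<bar> + 1) = w \<bullet> w" using ww by (simp_all add: s_def)
    have "s * (2 * (w \<bullet> w)) \<le> s * (s * q)" using key[of s] by (simp add: power2_eq_square mult_ac)
    then have "2 * (w \<bullet> w) \<le> s * q" using s(1) by simp
    also have "\<dots> \<le> s * (\<bar>q\<bar> + 1)" using s(1) by (intro mult_left_mono) auto
    finally show False using s(2) ww by simp
  qed
  then have "A *v v = M *\<^sub>R v" by (simp add: w_def)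
  with v that show thesis by blast
qed

text \<open>By symmetry the complement of an eigenvector in \<open>V\<close> is again invariant, and
  its dimension is one less.\<close>

lemma symmetric_matrix_orthonormal_eigenbasis:
  fixes A :: "real^'n^'n"
  assumes sym: "transpose A = A"
  shows "subspace V \<Longrightarrow> (\<And>v. v \<in> V \<Longrightarrow> A *v v \<in> V) \<Longrightarrow>
    \<exists>B. finite B \<and> card B = dim V \<and> B \<subseteq> V \<and> pairwise orthogonal B \<and>
      (\<forall>v\<in>B. norm v = 1 \<and> (\<exists>c. A *v v = c *\<^sub>R v))"
proof (induction "dim V" arbitrary: V)
  case 0
  then show ?case by (intro exI[of _ "{}"]) auto
next
  case (Suc d)
  then have "V \<noteq> {0}" by auto
  then obtain v c where v: "v \<in> V" "norm v = 1" "A *v v = c *\<^sub>R v"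
    using symmetric_matrix_eigenvector[OF sym Suc.prems(1)] Suc.prems(2) by metis
  define W where "W = {y \<in> V. orthogonal v y}"
  have W: "subspace W" unfolding W_def using Suc.prems(1)
    by (auto simp: subspace_def orthogonal_def inner_add_right)
  have Winv: "A *v y \<in> W" if "y \<in> W" for y
    using that Suc.prems(2) v(3) symmetric_matrix_inner[OF sym, of v y]
    by (auto simp: W_def orthogonal_def)
  have "dim {y \<in> span V. \<forall>x\<in>span {v}. orthogonal x y} + dim (span {v}) = dim (span V)"
    using v(1) by (intro dim_subspace_orthogonal_to_vectors) (auto simp: span_mono)
  moreover have "{y \<in> span V. \<forall>x\<in>span {v}. orthogonal x y} = W"
  proof -
    have "(\<forall>x\<in>span {v}. orthogonal x y) \<longleftrightarrow> orthogonal v y" for y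
    proof
      show "orthogonal v y" if "\<forall>x\<in>span {v}. orthogonal x y" using that span_base[of v "{v}"] by blast
    qed (auto simp: span_singleton orthogonal_clauses)
    moreover have "span V = V" using Suc.prems(1) by simp
    ultimately show ?thesis unfolding W_def by (simp only:)
  qed
  moreover have "v \<noteq> 0" using v(2) by auto
  ultimately have "dim W + 1 = dim V" by (simp add: dim_span dim_singleton)
  then have "d = dim W" using Suc.hyps(2) by simp
  from Suc.hyps(1)[OF this W Winv]
  obtain B where B: "finite B" "card B = dim W" "B \<subseteq> W" "pairwise orthogonal B"
    "\<forall>v\<in>B. norm v = 1 \<and> (\<exists>c. A *v v = c *\<^sub>R v)" by blast
  have "v \<notin> B" using B(3) \<open>v \<noteq> 0\<close> by (auto simp: W_def orthogonal_def)
  have "\<forall>y\<in>B. orthogonal v y" using B(3) by (auto simp: W_def)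
  then show ?case
    using B v \<open>v \<notin> B\<close> \<open>dim W + 1 = dim V\<close>
    by (intro exI[of _ "insert v B"]) (auto simp: pairwise_insert orthogonal_commute W_def)
qed

lemma spectral_decomp_exists:
  fixes A :: "real^'n^'n"
  assumes sym: "transpose A = A"
  obtains lam x where "spectral_decomp A lam x"
proof -
  obtain B where B: "finite B" "card B = CARD('n)" "pairwise orthogonal B"
    and eig: "\<And>v. v \<in> B \<Longrightarrow> norm v = 1 \<and> (\<exists>c. A *v v = c *\<^sub>R v)"
    using symmetric_matrix_orthonormal_eigenbasis[OF sym, of UNIV] by auto
  obtain x :: "'n \<Rightarrow> real^'n" where x: "bij_betw x UNIV B"
    using finite_same_card_bij[of "UNIV :: 'n set" B] B by auto
  then have xB: "x i \<in> B" for i by (auto simp: bij_betw_def)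
  obtain lam where lam: "\<And>i. A *v x i = lam i *\<^sub>R x i" using eig[OF xB] by metis
  have on: "x i \<bullet> x j = (if i = j then 1 else 0)" for i j
  proof (cases "i = j")
    case True
    then show ?thesis using eig[OF xB] by (simp add: norm_eq_1)
  next
    case False
    then have "x i \<noteq> x j" using x by (auto simp: bij_betw_def inj_on_def)
    with B(3) xB False show ?thesis by (auto simp: pairwise_def orthogonal_def)
  qed
  define Q :: "real^'n^'n" where "Q = (\<chi> k. x k)"
  have QQ: "transpose Q ** Q = mat 1" unfolding Q_def by (rule orthonormal_transpose[OF on])
  have "A $ r $ c = (\<Sum>i\<in>UNIV. lam i *\<^sub>R outer_prod (x i) (x i)) $ r $ c" for r c
  proof -
    \<comment> \<open>The columns of \<open>A ** transpose Q\<close> are the vectors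
      \<open>A *v x i\<close>.\<close>
    have "A = (A ** transpose Q) ** Q" using QQ by (simp add: matrix_mul_assoc[symmetric])
    then have "A $ r $ c = ((A ** transpose Q) ** Q) $ r $ c" by (rule arg_cong)
    also have "\<dots> = (\<Sum>i\<in>UNIV. (A *v x i) $ r * x i $ c)"
      by (simp add: matrix_matrix_mult_def matrix_vector_mult_def transpose_def Q_def)
    finally show ?thesis by (simp add: lam outer_prod_def mult_ac)
  qed
  then have "spectral_decomp A lam x" using on unfolding spectral_decomp_def by (simp add: vec_eq_iff)
  with that show thesis by blast
qed

section \<open>The critical exponent\<close>

lemma spectral_sum_nth:
  "(\<Sum>k\<in>UNIV. lam k *\<^sub>R outer_prod (x k) (x k)) $ i $ j = (\<Sum>k\<in>UNIV. lam k * (x k $ i * x k $ j))"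
  by (simp add: outer_prod_def)

lemma spectral_sum_quadratic_form:
  fixes x :: "'n::finite \<Rightarrow> real^'n"
  shows "v \<bullet> ((\<Sum>k\<in>UNIV. lam k *\<^sub>R outer_prod (x k) (x k)) *v v) = (\<Sum>k\<in>UNIV. lam k * (x k \<bullet> v)\<^sup>2)"
proof -
  have "outer_prod (x k) (x k) *v v = (x k \<bullet> v) *\<^sub>R x k" for k
    by (simp add: vec_eq_iff outer_prod_def matrix_vector_mult_def inner_vec_def sum_distrib_left mult_ac)
  then have "(lam k *\<^sub>R outer_prod (x k) (x k)) *v v = (lam k * (x k \<bullet> v)) *\<^sub>R x k" for k
    by (simp add: scaleR_matrix_vector_assoc[symmetric])
  then have "(\<Sum>k\<in>UNIV. lam k *\<^sub>R outer_prod (x k) (x k)) *v v = (\<Sum>k\<in>UNIV. (lam k * (x k \<bullet> v)) *\<^sub>R x k)"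
    by (simp add: linear_sum[OF linearI[of "\<lambda>M. M *v v"]] matrix_vector_mult_add_rdistrib
        scaleR_matrix_vector_assoc)
  then show ?thesis
    by (simp add: inner_sum_right power2_eq_square inner_commute mult_ac)
qed

lemma spectral_decomp_eigenvalue_nonneg:
  assumes "psd_matrix A" "spectral_decomp A lam x"
  shows "0 \<le> lam i"
proof -
  have on: "x k \<bullet> x i = (if k = i then 1 else 0)" for k
    using assms(2) by (simp add: spectral_decomp_def)
  have "0 \<le> x i \<bullet> (A *v x i)" using assms(1) by (simp add: psd_matrix_def)
  also have "\<dots> = (\<Sum>k\<in>UNIV. lam k * (x k \<bullet> x i)\<^sup>2)"
    using assms(2) by (simp add: spectral_decomp_def spectral_sum_quadratic_form)
  also have "\<dots> = lam i" by (simp add: on if_distrib[of "\<lambda>y. y\<^sup>2"] if_distrib[of "\<lambda>y. _ * y"] cong: if_cong)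
  finally show ?thesis .
qed

text \<open>Holds for every decomposition, so the choice made by \<open>SOME\<close> in
  \<open>mat_powr\<close> is immaterial.\<close>

lemma doubly_nonneg_spectral_powr:
  fixes A :: "real^'n^'n" and n :: real
  defines "n \<equiv> real CARD('n)"
  assumes A: "doubly_nonneg A" and sd: "spectral_decomp A lam x"
    and t: "(if odd CARD('n) then (n\<^sup>2 - 4 * n + 5) / 2 else (n\<^sup>2 - 5 * n + 8) / 2) \<le> t" "0 < t"
  shows "doubly_nonneg (\<Sum>k\<in>UNIV. (lam k powr t) *\<^sub>R outer_prod (x k) (x k))" (is "doubly_nonneg ?B")
proof -
  have lam: "0 \<le> lam k" for k
    using A sd spectral_decomp_eigenvalue_nonneg by (auto simp: doubly_nonneg_def)
  have on: "x i \<bullet> x j = (if i = j then 1 else 0)" for i j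
    using sd by (simp add: spectral_decomp_def)
  have entry: "0 \<le> (\<Sum>k\<in>UNIV. lam k * (x k $ i * x k $ j))" for i j
    using A sd unfolding doubly_nonneg_def spectral_decomp_def spectral_sum_nth[symmetric] by simp
  have rows: "0 \<le> (\<Sum>k\<in>UNIV. x k $ i * x k $ j)" for i j
    by (simp add: orthonormal_rows[OF on])
  \<comment> \<open>these are the spectral data of \<open>A + \<epsilon> I\<close>\<close>
  have pos: "positive_spectral_data (\<lambda>k. lam k + \<epsilon>) x" if "0 < \<epsilon>" for \<epsilon>
    using that on lam entry rows
    by unfold_locales (auto simp: add_nonneg_pos distrib_right sum.distrib sum_distrib_left[symmetric])
  have "0 \<le> (\<Sum>k\<in>UNIV. lam k powr t * (x k $ i * x k $ j))" for i j
  proof (rule tendsto_lowerbound)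
    show "((\<lambda>\<epsilon>. \<Sum>k\<in>UNIV. (lam k + \<epsilon>) powr t * (x k $ i * x k $ j)) \<longlongrightarrow>
        (\<Sum>k\<in>UNIV. lam k powr t * (x k $ i * x k $ j))) (at_right 0)"
    proof (intro tendsto_sum tendsto_mult_right)
      fix k
      have "((\<lambda>\<epsilon>. lam k + \<epsilon>) \<longlongrightarrow> lam k + 0) (at_right 0)" by (intro tendsto_intros)
      \<comment> \<open>Continuity of the power at a zero eigenvalue rests on \<open>0 < t\<close>
        and a nonnegative base.\<close>
      moreover have "eventually (\<lambda>\<epsilon>. 0 \<le> lam k + \<epsilon>) (at_right 0)"
        using eventually_at_right_less[of 0] by eventually_elim (use lam[of k] in simp)
      ultimately show "((\<lambda>\<epsilon>. (lam k + \<epsilon>) powr t) \<longlongrightarrow> lam k powr t) (at_right 0)"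
        using t(2) by (intro tendsto_powr') auto
    qed
    show "eventually (\<lambda>\<epsilon>. 0 \<le> (\<Sum>k\<in>UNIV. (lam k + \<epsilon>) powr t * (x k $ i * x k $ j))) (at_right 0)"
      using eventually_at_right_less[of 0]
    proof eventually_elim
      case (elim \<epsilon>)
      then interpret positive_spectral_data "\<lambda>k. lam k + \<epsilon>" x by (rule pos)
      show ?case using pow_nonneg[OF t(1)[unfolded n_def], unfolded pow_def] .
    qed
  qed simp
  moreover have "transpose ?B = ?B"
    by (simp add: vec_eq_iff transpose_def outer_prod_def mult_ac)
  moreover have "0 \<le> v \<bullet> (?B *v v)" for v
    unfolding spectral_sum_quadratic_form by (intro sum_nonneg) simp
  ultimately show ?thesis unfolding doubly_nonneg_def psd_matrix_def spectral_sum_nth by blast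
qed

lemma doubly_nonneg_mat_powr:
  fixes A :: "real^'n^'n" and n :: real
  defines "n \<equiv> real CARD('n)"
  assumes A: "doubly_nonneg A"
    and t: "(if odd CARD('n) then (n\<^sup>2 - 4 * n + 5) / 2 else (n\<^sup>2 - 5 * n + 8) / 2) \<le> t" "0 < t"
  shows "doubly_nonneg (mat_powr A t)"
proof -
  have "transpose A = A" using A by (simp add: doubly_nonneg_def)
  then obtain lam x where "spectral_decomp A lam x" by (rule spectral_decomp_exists)
  then have "\<exists>B lam x. spectral_decomp A lam x \<and>
      B = (\<Sum>i\<in>UNIV. (lam i powr t) *\<^sub>R outer_prod (x i) (x i))" by blast
  from someI_ex[OF this] obtain lam x where "spectral_decomp A lam x"
    and "mat_powr A t = (\<Sum>i\<in>UNIV. (lam i powr t) *\<^sub>R outer_prod (x i) (x i))"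
    unfolding mat_powr_def by blast
  with doubly_nonneg_spectral_powr[OF A _ t[unfolded n_def]] show ?thesis by simp
qed

theorem theorem3p1:
  fixes n :: nat
  assumes "n = CARD('n::finite)"
  shows "crit_exp TYPE('n) \<le>
           (if odd n then (real n ^ 2 - 4 * real n + 5) / 2
            else (real n ^ 2 - 5 * real n + 8) / 2)"
proof -
  let ?b = "if odd n then (real n ^ 2 - 4 * real n + 5) / 2 else (real n ^ 2 - 5 * real n + 8) / 2"
  \<comment> \<open>Completing the square shows that the bound is nonnegative, as members of the set
    under the infimum must be.\<close>
  have "real n ^ 2 - 4 * real n + 5 = (real n - 2)\<^sup>2 + 1"
    "real n ^ 2 - 5 * real n + 8 = (real n - 5 / 2)\<^sup>2 + 7 / 4"
    by (simp_all add: power2_eq_square algebra_simps)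
  then have "0 \<le> real n ^ 2 - 4 * real n + 5" "0 \<le> real n ^ 2 - 5 * real n + 8"
    by (simp_all only: add_nonneg_nonneg zero_le_power2)
  then have "0 \<le> ?b" by simp
  then show ?thesis
    unfolding crit_exp_def using doubly_nonneg_mat_powr[where 'n = 'n] assms
    by (intro cInf_lower bdd_belowI[of _ 0]) auto
qed

end
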